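(* Let $P(X)\in\mathbb{Z}[X]$ be a polynomial of degree $d$, and assume $d\ge 2$. If $\tau\in(d,d+1]$, then $$\dim W_{\tau}(P_{\alpha})\le\frac{d+1-\tau}{\tau}$$ for almost all $\alpha\in\mathbb{R}$ (with respect to Lebesgue measure).
   Context: For a real number $\alpha$ and $\tau>0$, $W_{\tau}(P_{\alpha})$ denotes the set of all $x\in\mathbb{R}$ such that $$\left|x-\frac{p}{q}\right|<\frac{1}{q^{\tau}}\quad\text{and}\quad\left|P(x)+\alpha-\frac{r}{q}\right|<\frac{1}{q^{\tau}}$$ for infinitely many triples of integers $(p,r,q)$ with $q\ge 1$. $\dim$ denotes Hausdorff dimension (with the usual convention $\dim\emptyset=0$). "Almost all" means that the set of exceptions has Lebesgue measure zero. *)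

theory Defs
  imports "HOL-Analysis.Analysis" "HOL-Computational_Algebra.Polynomial"
begin

text \<open>
  The contribution of a covering set to the Hausdorff sum: \<open>(diam U)\<^sup>s\<close>, where \<open>0\<^sup>0 = 1\<close> for a
  nonempty set and the empty set contributes nothing (note that \<open>0 powr 0 = 0\<close> in HOL).
\<close>
definition hausdorff_gauge :: "real \<Rightarrow> 'a::metric_space set \<Rightarrow> real" where
  "hausdorff_gauge s U =
     (if U = {} then 0 else if s = 0 then 1 else diameter U powr s)"

text \<open>
  Boundedness of the covering sets is required explicitly because \<open>diameter\<close> is real-valued and
  hence unspecified on unbounded sets. Finite covers are included, as the \<open>U i\<close> may be empty.
\<close>
definition hausdorff_premeasure :: "real \<Rightarrow> real \<Rightarrow> 'a::metric_space set \<Rightarrow> ennreal" where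
  "hausdorff_premeasure s \<delta> A =
     Inf {(\<Sum>i. ennreal (hausdorff_gauge s (U i))) | U :: nat \<Rightarrow> 'a set.
            A \<subseteq> (\<Union>i. U i) \<and> (\<forall>i. bounded (U i) \<and> diameter (U i) \<le> \<delta>)}"

definition hausdorff_measure :: "real \<Rightarrow> 'a::metric_space set \<Rightarrow> ennreal" where
  "hausdorff_measure s A = (SUP \<delta>\<in>{0<..}. hausdorff_premeasure s \<delta> A)"

definition hausdorff_dim :: "'a::metric_space set \<Rightarrow> ereal" where
  "hausdorff_dim A = Inf {ereal s | s. s \<ge> 0 \<and> hausdorff_measure s A = 0}"

lemma hausdorff_dim_empty: "hausdorff_dim ({} :: 'a::metric_space set) = 0"
proof -
  have "hausdorff_premeasure 0 \<delta> ({} :: 'a set) = 0" if "\<delta> > 0" for \<delta>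
  proof -
    have "hausdorff_premeasure 0 \<delta> ({} :: 'a set)
            \<le> (\<Sum>i. ennreal (hausdorff_gauge 0 ((\<lambda>_. {} :: 'a set) (i::nat))))"
      unfolding hausdorff_premeasure_def
      by (rule Inf_lower) (use that in \<open>auto intro!: exI[of _ "\<lambda>_. {}"]\<close>)
    also have "\<dots> = 0"
      by (simp add: hausdorff_gauge_def)
    finally show ?thesis
      by simp
  qed
  then have "hausdorff_measure 0 ({} :: 'a set) = 0"
    unfolding hausdorff_measure_def by (simp add: SUP_eq_const)
  then have "hausdorff_dim ({} :: 'a set) \<le> ereal 0"
    unfolding hausdorff_dim_def by (intro Inf_lower) auto
  moreover have "0 \<le> hausdorff_dim ({} :: 'a set)"
    unfolding hausdorff_dim_def by (rule Inf_greatest) auto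
  ultimately show ?thesis
    by (simp add: zero_ereal_def)
qed

text \<open>
  The triples \<open>(p, r, q)\<close> are not required to be in lowest terms.
\<close>
definition W_approx :: "real \<Rightarrow> (real \<Rightarrow> real) \<Rightarrow> real set" where
  "W_approx \<tau> f = {x. infinite {(p :: int, r :: int, q :: int). q \<ge> 1 \<and>
       \<bar>x - of_int p / of_int q\<bar> < 1 / (of_int q powr \<tau>) \<and>
       \<bar>f x - of_int r / of_int q\<bar> < 1 / (of_int q powr \<tau>)}}"

definition poly_plus_const :: "int poly \<Rightarrow> real \<Rightarrow> real \<Rightarrow> real" where
  "poly_plus_const P \<alpha> x = poly (map_poly of_int P) x + \<alpha>"

end

theory Submission
  imports Defs
begin

text \<open>
  The argument is a first moment estimate. If \<open>(p, r, q)\<close> is admissible for a bounded \<open>x\<close>, then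
  \<open>\<alpha>\<close> lies within \<open>O(q\<^sup>-\<^sup>\<tau>)\<close> of \<open>r/q - P(p/q)\<close>, and only \<open>O(q\<^sup>2)\<close> pairs \<open>(p, r)\<close> matter for each
  \<open>q\<close>. So the expected value over \<open>\<alpha>\<close> of the Hausdorff \<open>s\<close>-sum of the cover of the points \<open>x\<close>
  by balls of radius \<open>q\<^sup>-\<^sup>\<tau>\<close> about \<open>p/q\<close> is \<open>O(\<Sum> q\<^sup>2 q\<^sup>-\<^sup>\<tau> q\<^sup>-\<^sup>\<tau>\<^sup>s)\<close>, which is finite for \<open>s > (3 - \<tau>)/\<tau>\<close>.
  As \<open>d \<ge> 2\<close>, this already covers every \<open>s > (d + 1 - \<tau>)/\<tau>\<close>.
\<close>

section \<open>Hausdorff measure\<close>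

lemma hausdorff_premeasure_le_suminf:
  assumes "A \<subseteq> (\<Union>i. U i)" "\<And>i. bounded (U i)" "\<And>i. diameter (U i) \<le> \<delta>"
  shows "hausdorff_premeasure s \<delta> A \<le> (\<Sum>i. ennreal (hausdorff_gauge s (U i)))"
  unfolding hausdorff_premeasure_def using assms by (intro Inf_lower) auto

lemma hausdorff_premeasure_mono:
  "A \<subseteq> B \<Longrightarrow> hausdorff_premeasure s \<delta> A \<le> hausdorff_premeasure s \<delta> B"
  unfolding hausdorff_premeasure_def by (intro Inf_superset_mono) auto

lemma hausdorff_premeasure_le_gauge:
  assumes "bounded U" "diameter U \<le> \<delta>" "0 \<le> \<delta>"
  shows "hausdorff_premeasure s \<delta> U \<le> ennreal (hausdorff_gauge s U)"
proof -
  \<comment> \<open>Covers are infinite sequences, so the single set \<open>U\<close> is padded with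
    empty sets, whose gauge is 0 even for \<open>s = 0\<close> and whose diameter 0 is at most
    \<open>\<delta>\<close>.\<close>
  define V where "V i = (if i = 0 then U else {})" for i :: nat
  have "hausdorff_premeasure s \<delta> U \<le> (\<Sum>i. ennreal (hausdorff_gauge s (V i)))"
    by (rule hausdorff_premeasure_le_suminf) (use assms in \<open>auto simp: V_def\<close>)
  also have "\<dots> = (\<Sum>i\<in>{0}. ennreal (hausdorff_gauge s (V i)))"
    by (rule suminf_finite) (auto simp: V_def hausdorff_gauge_def)
  finally show ?thesis by (simp add: V_def)
qed

text \<open>Each \<open>A n\<close> has a cover that is optimal up to e/2^(n+1). Merging these
  covers into one sequence by \<open>prod_decode\<close> costs at most e in total.\<close>

lemma hausdorff_premeasure_UN_le:
  fixes A :: "nat \<Rightarrow> 'a::metric_space set"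
  shows "hausdorff_premeasure s \<delta> (\<Union>n. A n) \<le> (\<Sum>n. hausdorff_premeasure s \<delta> (A n))"
proof (rule ennreal_le_epsilon)
  fix e :: real
  \<comment> \<open>Finiteness of the sum makes every single premeasure finite; only then does
    adding \<open>h n\<close> give a strictly larger bound, below which the infimum supplies a
    cover.\<close>
  assume fin: "(\<Sum>n. hausdorff_premeasure s \<delta> (A n)) < top" and "0 < e"
  have ne: "hausdorff_premeasure s \<delta> (A n) \<noteq> \<infinity>" for n
    using ennreal_suminf_lessD[OF fin, of n] by auto
  define h where "h n = e * (1/2) ^ Suc n" for n :: nat
  have h: "h n > 0" for n using \<open>0 < e\<close> by (simp add: h_def)
  have "\<exists>U :: nat \<Rightarrow> 'a set. A n \<subseteq> (\<Union>i. U i) \<and> (\<forall>i. bounded (U i) \<and> diameter (U i) \<le> \<delta>) \<and>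
      (\<Sum>i. ennreal (hausdorff_gauge s (U i))) < hausdorff_premeasure s \<delta> (A n) + ennreal (h n)" for n
  proof -
    have "hausdorff_premeasure s \<delta> (A n) < hausdorff_premeasure s \<delta> (A n) + ennreal (h n)"
      using ne[of n] h[of n] by (cases "hausdorff_premeasure s \<delta> (A n)")
        (auto simp flip: ennreal_plus intro!: ennreal_lessI)
    then show ?thesis
      by (subst (asm) (1) hausdorff_premeasure_def) (auto simp: Inf_less_iff)
  qed
  then obtain U :: "nat \<Rightarrow> nat \<Rightarrow> 'a set" where
    U: "\<And>n. A n \<subseteq> (\<Union>i. U n i)" "\<And>n i. bounded (U n i)" "\<And>n i. diameter (U n i) \<le> \<delta>" and
    le: "\<And>n. (\<Sum>i. ennreal (hausdorff_gauge s (U n i))) < hausdorff_premeasure s \<delta> (A n) + ennreal (h n)"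
    by metis
  define V where "V k = (case prod_decode k of (n, i) \<Rightarrow> U n i)" for k
  have "(\<Union>n. A n) \<subseteq> (\<Union>k. V k)"
  proof
    fix x assume "x \<in> (\<Union>n. A n)"
    then obtain n i where "x \<in> U n i" using U(1) by blast
    then have "x \<in> V (prod_encode (n, i))" by (simp add: V_def)
    then show "x \<in> (\<Union>k. V k)" by blast
  qed
  then have "hausdorff_premeasure s \<delta> (\<Union>n. A n) \<le> (\<Sum>k. ennreal (hausdorff_gauge s (V k)))"
    by (rule hausdorff_premeasure_le_suminf) (auto simp: V_def U split: prod.split)
  also have "\<dots> = (\<Sum>k. (\<lambda>(n, i). ennreal (hausdorff_gauge s (U n i))) (prod_decode k))"
    by (simp add: V_def case_prod_beta)
  also have "\<dots> = (\<Sum>n. \<Sum>i. ennreal (hausdorff_gauge s (U n i)))"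
    by (rule suminf_ennreal_2dimen) simp
  also have "\<dots> \<le> (\<Sum>n. hausdorff_premeasure s \<delta> (A n) + ennreal (h n))"
    using le by (intro suminf_le) (auto intro: less_imp_le)
  also have "\<dots> = (\<Sum>n. hausdorff_premeasure s \<delta> (A n)) + (\<Sum>n. ennreal (h n))"
    by (rule suminf_add[symmetric]) auto
  also have "(\<Sum>n. ennreal (h n)) = ennreal e"
  proof -
    have "h sums (e * 1)" unfolding h_def by (intro sums_mult power_half_series)
    then show ?thesis
      using h by (subst suminf_ennreal_eq[where x = e]) (auto intro: less_imp_le)
  qed
  finally show "hausdorff_premeasure s \<delta> (\<Union>n. A n) \<le> (\<Sum>n. hausdorff_premeasure s \<delta> (A n)) + ennreal e" .
qed

lemma hausdorff_premeasure_empty: "0 \<le> \<delta> \<Longrightarrow> hausdorff_premeasure s \<delta> {} = 0"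
  using hausdorff_premeasure_le_gauge[of "{}" \<delta> s] by (simp add: hausdorff_gauge_def)

lemma hausdorff_premeasure_Un_le:
  assumes "0 \<le> \<delta>"
  shows "hausdorff_premeasure s \<delta> (A \<union> B) \<le> hausdorff_premeasure s \<delta> A + hausdorff_premeasure s \<delta> B"
  using hausdorff_premeasure_UN_le[of s \<delta> "binaryset A B"]
    suminf_binaryset_eq[of "hausdorff_premeasure s \<delta>" A B, OF hausdorff_premeasure_empty[OF assms]]
  by (simp add: UN_binaryset_eq)

lemma hausdorff_premeasure_finite_UN_le:
  assumes "finite I" "0 \<le> \<delta>"
  shows "hausdorff_premeasure s \<delta> (\<Union>i\<in>I. A i) \<le> (\<Sum>i\<in>I. hausdorff_premeasure s \<delta> (A i))"
  using assms(1)
proof induction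
  case empty
  then show ?case by (simp add: hausdorff_premeasure_empty assms)
next
  case (insert i I)
  have "hausdorff_premeasure s \<delta> (A i \<union> (\<Union>i\<in>I. A i))
      \<le> hausdorff_premeasure s \<delta> (A i) + hausdorff_premeasure s \<delta> (\<Union>i\<in>I. A i)"
    by (rule hausdorff_premeasure_Un_le[OF assms(2)])
  also have "\<dots> \<le> hausdorff_premeasure s \<delta> (A i) + (\<Sum>i\<in>I. hausdorff_premeasure s \<delta> (A i))"
    by (intro add_left_mono insert)
  finally show ?case using insert by simp
qed

section \<open>Null sets of the Hausdorff measure\<close>

lemma hausdorff_measure_eq_0_iff:
  "hausdorff_measure s A = 0 \<longleftrightarrow> (\<forall>\<delta>>0. hausdorff_premeasure s \<delta> A = 0)"
  unfolding hausdorff_measure_def bot_ennreal[symmetric] by (auto simp: SUP_bot_conv)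

lemma hausdorff_measure_UN_eq_0:
  fixes A :: "nat \<Rightarrow> 'a::metric_space set"
  assumes "\<And>n. hausdorff_measure s (A n) = 0"
  shows "hausdorff_measure s (\<Union>n. A n) = 0"
proof -
  have "hausdorff_premeasure s \<delta> (\<Union>n. A n) = 0" if "\<delta> > 0" for \<delta>
    using hausdorff_premeasure_UN_le[of s \<delta> A] assms that by (simp add: hausdorff_measure_eq_0_iff)
  then show ?thesis by (simp add: hausdorff_measure_eq_0_iff)
qed

lemma hausdorff_measure_mono_0:
  "A \<subseteq> B \<Longrightarrow> hausdorff_measure s B = 0 \<Longrightarrow> hausdorff_measure s A = 0"
  by (metis hausdorff_measure_eq_0_iff hausdorff_premeasure_mono le_zero_eq)

text \<open>The convergence half of the Borel--Cantelli lemma for Hausdorff measures.\<close>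

lemma hausdorff_measure_limsup_eq_0:
  fixes U :: "nat \<Rightarrow> 'i \<Rightarrow> 'a::metric_space set"
  assumes s: "s > 0"
    and fin: "\<And>n. finite (I n)"
    and bdd: "\<And>n i. bounded (U n i)"
    and summ: "summable (\<lambda>n. \<Sum>i\<in>I n. diameter (U n i) powr s)"
    and cover: "\<And>x. x \<in> A \<Longrightarrow> \<exists>\<^sub>\<infinity>n. \<exists>i\<in>I n. x \<in> U n i"
  shows "hausdorff_measure s A = 0"
proof -
  define g where "g n = (\<Sum>i\<in>I n. diameter (U n i) powr s)" for n
  have g_nonneg: "0 \<le> g n" for n by (simp add: g_def sum_nonneg)
  have "hausdorff_premeasure s \<delta> A = 0" if "\<delta> > 0" for \<delta>
  proof -
    have le_eps: "hausdorff_premeasure s \<delta> A \<le> 0 + ennreal e" if "e > 0" for e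
    proof -
      \<comment> \<open>The starting index \<open>N\<close> has to do two things: make the tail sum
        smaller than \<open>e\<close>, and make each \<open>g n\<close> smaller than
        \<open>\<delta> powr s\<close>. Since one summand never exceeds \<open>g n\<close>, the
        second condition forces every diameter in the tail to be at most \<open>\<delta>\<close>, so
        the tail is an admissible cover.\<close>
      have "g \<longlonglongrightarrow> 0" using summ unfolding g_def by (rule summable_LIMSEQ_zero)
      then have "eventually (\<lambda>n. g n < \<delta> powr s) sequentially"
        using \<open>\<delta> > 0\<close> by (intro order_tendstoD) auto
      moreover have "eventually (\<lambda>N. norm (\<Sum>n. g (n + N)) < e) sequentially"
        using suminf_exist_split[OF \<open>e > 0\<close>, of g] summ
        unfolding g_def eventually_sequentially by auto
      ultimately obtain N where small: "\<And>n. n \<ge> N \<Longrightarrow> g n < \<delta> powr s"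
        and tail: "norm (\<Sum>n. g (n + N)) < e"
        unfolding eventually_sequentially by (metis le_trans nat_le_linear)
      have diam: "diameter (U n i) \<le> \<delta>" if "n \<ge> N" "i \<in> I n" for n i
      proof (rule ccontr)
        assume "\<not> diameter (U n i) \<le> \<delta>"
        then have "\<delta> powr s \<le> diameter (U n i) powr s"
          using s \<open>\<delta> > 0\<close> by (intro powr_mono2) auto
        also have "\<dots> \<le> g n"
          unfolding g_def using fin that by (intro member_le_sum) auto
        finally show False using small[OF \<open>n \<ge> N\<close>] by simp
      qed
      have "A \<subseteq> (\<Union>n. \<Union>i\<in>I (n + N). U (n + N) i)"
      proof
        fix x assume "x \<in> A"
        then obtain n i where "n \<ge> N" "i \<in> I n" "x \<in> U n i"
          using cover unfolding INFM_nat_le by blast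
        then have "x \<in> (\<Union>i\<in>I (n - N + N). U (n - N + N) i)" by auto
        then show "x \<in> (\<Union>n. \<Union>i\<in>I (n + N). U (n + N) i)" by blast
      qed
      then have "hausdorff_premeasure s \<delta> A \<le>
          (\<Sum>n. hausdorff_premeasure s \<delta> (\<Union>i\<in>I (n + N). U (n + N) i))"
        by (rule order_trans[OF hausdorff_premeasure_mono hausdorff_premeasure_UN_le])
      also have "\<dots> \<le> (\<Sum>n. ennreal (g (n + N)))"
      proof (intro suminf_le summableI)
        fix n
        have "hausdorff_premeasure s \<delta> (\<Union>i\<in>I (n + N). U (n + N) i)
            \<le> (\<Sum>i\<in>I (n + N). hausdorff_premeasure s \<delta> (U (n + N) i))"
          using \<open>\<delta> > 0\<close> by (intro hausdorff_premeasure_finite_UN_le fin) auto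
        also have "\<dots> \<le> (\<Sum>i\<in>I (n + N). ennreal (diameter (U (n + N) i) powr s))"
        proof (rule sum_mono)
          fix i assume "i \<in> I (n + N)"
          then have "hausdorff_premeasure s \<delta> (U (n + N) i) \<le> ennreal (hausdorff_gauge s (U (n + N) i))"
            using \<open>\<delta> > 0\<close> by (intro hausdorff_premeasure_le_gauge bdd diam) auto
          also have "\<dots> \<le> ennreal (diameter (U (n + N) i) powr s)"
            using s by (intro ennreal_leI) (simp add: hausdorff_gauge_def)
          finally show "hausdorff_premeasure s \<delta> (U (n + N) i) \<le> ennreal (diameter (U (n + N) i) powr s)" .
        qed
        finally show "hausdorff_premeasure s \<delta> (\<Union>i\<in>I (n + N). U (n + N) i) \<le> ennreal (g (n + N))"
          by (simp add: g_def)
      qed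
      also have "\<dots> = ennreal (\<Sum>n. g (n + N))"
        using summ g_nonneg unfolding g_def[symmetric] by (intro suminf_ennreal2) (auto simp: summable_iff_shift)
      also have "\<dots> \<le> ennreal e" using tail by (intro ennreal_leI) auto
      finally show ?thesis by simp
    qed
    have "hausdorff_premeasure s \<delta> A \<le> 0" by (rule ennreal_le_epsilon) (rule le_eps)
    then show ?thesis by simp
  qed
  then show ?thesis by (simp add: hausdorff_measure_eq_0_iff)
qed

section \<open>Rational approximation on vertical translates of a graph\<close>

text \<open>A fixed denominator admits only finitely many numerators, because the errors are at most
  1. Infinitely many triples therefore involve infinitely many denominators, which are indexed as
  \<open>Suc n\<close> to start at 1.\<close>

lemma infinitely_many_denominators:
  assumes x: "x \<in> W_approx \<tau> f" and "\<tau> > 0"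
  shows "\<exists>\<^sub>\<infinity>n. \<exists>(p :: int) (r :: int). \<bar>x - p / Suc n\<bar> < Suc n powr -\<tau> \<and> \<bar>f x - r / Suc n\<bar> < Suc n powr -\<tau>"
proof (rule ccontr)
  define T where "T = {(p :: int, r :: int, q :: int). q \<ge> 1 \<and>
       \<bar>x - of_int p / of_int q\<bar> < 1 / (of_int q powr \<tau>) \<and>
       \<bar>f x - of_int r / of_int q\<bar> < 1 / (of_int q powr \<tau>)}"
  assume "\<not> ?thesis"
  then obtain N where N: "\<And>n p r. n \<ge> N \<Longrightarrow>
      \<not> (\<bar>x - of_int p / Suc n\<bar> < Suc n powr -\<tau> \<and> \<bar>f x - of_int r / Suc n\<bar> < Suc n powr -\<tau>)"
    unfolding INFM_nat_le by blast
  \<comment> \<open>If q lies between 1 and \<open>N\<close>, an error below 1 gives |u/q| \<le> |y|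
    + 1, hence |u| \<le> (|y| + 1) \<open>N\<close>.\<close>
  define K where "K y = \<lceil>(\<bar>y\<bar> + 1) * N\<rceil>" for y :: real
  have num: "u \<in> {- K y..K y}"
    if "1 \<le> q" "q \<le> int N" "\<bar>y - of_int u / of_int q\<bar> < 1 / (of_int q powr \<tau>)" for u q :: int and y
  proof -
    have "1 / (of_int q powr \<tau>) \<le> (1 :: real)" using that \<open>\<tau> > 0\<close> by (simp add: ge_one_powr_ge_zero)
    then have "\<bar>of_int u / of_int q :: real\<bar> \<le> \<bar>y\<bar> + 1" using that by linarith
    then have "\<bar>of_int u :: real\<bar> \<le> (\<bar>y\<bar> + 1) * of_int q" using that by (simp add: field_simps)
    also have "\<dots> \<le> (\<bar>y\<bar> + 1) * real N" using that by (intro mult_left_mono) auto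
    finally show ?thesis unfolding K_def by (simp add: abs_le_iff) linarith
  qed
  have "T \<subseteq> {- K x..K x} \<times> {- K (f x)..K (f x)} \<times> {1..int N}"
  proof safe
    fix p r q assume T: "(p, r, q) \<in> T"
    then have "q \<ge> 1" by (simp add: T_def)
    define n where "n = nat (q - 1)"
    have q: "q = int (Suc n)" using \<open>q \<ge> 1\<close> by (simp add: n_def)
    have "\<not> n \<ge> N" using N[of n p r] T by (auto simp: T_def q powr_minus_divide)
    then have "q \<le> int N" using q by simp
    with \<open>q \<ge> 1\<close> show "q \<in> {1..int N}" by simp
    show "p \<in> {- K x..K x}" "r \<in> {- K (f x)..K (f x)}"
      using num \<open>q \<ge> 1\<close> \<open>q \<le> int N\<close> T by (auto simp: T_def simp del: atLeastAtMost_iff)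
  qed
  then have "finite T" by (rule finite_subset) auto
  with x show False by (simp add: W_approx_def T_def)
qed

text \<open>Bounding both x and \<alpha> by \<open>M\<close> confines p/q and r/q to a fixed range,
  so each q has only O(q^2) relevant pairs. The Lipschitz interval is longer by 1 at each end
  because p/q may lie outside the range of x by up to 1.\<close>

lemma AE_hausdorff_measure_W_approx_bounded:
  fixes f :: "real \<Rightarrow> real" and M :: nat
  assumes "\<tau> > 0" "s > 0" and exponent: "\<tau> * (1 + s) > 3"
    and lip: "L-lipschitz_on {- (real M + 1)..real M + 1} f"
  shows "AE \<alpha> in lborel. \<bar>\<alpha>\<bar> \<le> M \<longrightarrow>
           hausdorff_measure s (W_approx \<tau> (\<lambda>x. f x + \<alpha>) \<inter> {- real M..real M}) = 0"
proof -
  have "L \<ge> 0" using lip by (rule lipschitz_on_nonneg)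
  \<comment> \<open>One error \<open>\<rho> n\<close> comes from approximating f(x) + \<alpha> by
    r/q, and \<open>L\<close> times as much from replacing f(x) by f(p/q).\<close>
  define C where "C = L + 1"
  have "C > 0" using \<open>L \<ge> 0\<close> by (simp add: C_def)
  have "bounded (f ` {- (real M + 1)..real M + 1})"
    by (intro compact_imp_bounded compact_continuous_image lipschitz_on_continuous_on[OF lip]) auto
  then obtain D where D: "\<And>x. \<bar>x\<bar> \<le> real M + 1 \<Longrightarrow> \<bar>f x\<bar> \<le> D"
    unfolding bounded_iff by (fastforce simp: abs_le_iff)
  \<comment> \<open>\<open>B\<close> bounds both |p/q| \<le> \<open>M\<close> + 1 and |r/q| \<le>
    \<open>D\<close> + \<open>M\<close> + 1, so \<open>S n\<close> contains all relevant
    numerators.\<close>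
  define B where "B = nat \<lceil>D\<rceil> + M + 1"
  have B: "1 \<le> B" "real M + 1 \<le> B" "D + real M + 1 \<le> B" unfolding B_def by (auto; linarith)+
  define S where "S n = {- int (B * Suc n)..int (B * Suc n)}" for n
  define \<rho> where "\<rho> n = real (Suc n) powr -\<tau>" for n
  have \<rho>: "0 < \<rho> n" "\<rho> n \<le> 1" for n
    using \<open>\<tau> > 0\<close> by (auto simp: \<rho>_def powr_minus_divide ge_one_powr_ge_zero)
  \<comment> \<open>\<open>E n (p, r)\<close> is a necessary condition on \<alpha> alone, free of x.
    Being an interval, it is measurable and has explicit length.\<close>
  define E where "E n pr = (case pr of (p, r) \<Rightarrow>
      ball (of_int r / Suc n - f (of_int p / Suc n)) (C * \<rho> n))" for n and pr :: "int \<times> int"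
  define U where "U n pr = (case pr of (p :: int, r :: int) \<Rightarrow> ball (of_int p / Suc n :: real) (\<rho> n))" for n pr
  define I where "I \<alpha> n = {pr \<in> S n \<times> S n. \<alpha> \<in> E n pr}" for \<alpha> n
  \<comment> \<open>This is the \<open>s\<close>-sum of the balls \<open>U n pr\<close> over
    \<open>I \<alpha> n\<close>. Indicators over the fixed index set \<open>S n \<times> S n\<close>
    allow termwise integration in \<alpha>.\<close>
  define h where "h \<alpha> n = (2 * \<rho> n) powr s * (\<Sum>pr\<in>S n \<times> S n. indicator (E n pr) \<alpha>)" for \<alpha> :: real and n
  have E_meas: "E n pr \<in> sets borel" for n pr by (auto simp: E_def split: prod.split)
  have finS: "finite (S n \<times> S n)" for n by (simp add: S_def)
  have h_nonneg: "0 \<le> h \<alpha> n" for \<alpha> n by (simp add: h_def sum_nonneg)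
  have h_eq: "h \<alpha> n = (\<Sum>pr\<in>I \<alpha> n. diameter (U n pr) powr s)" for \<alpha> n
  proof -
    have "diameter (U n pr) = 2 * \<rho> n" for pr
      using \<rho>(1)[of n] by (auto simp: U_def split: prod.split)
    then have "(\<Sum>pr\<in>I \<alpha> n. diameter (U n pr) powr s)
        = (\<Sum>pr\<in>S n \<times> S n. if \<alpha> \<in> E n pr then (2 * \<rho> n) powr s else 0)"
      unfolding I_def by (simp only: sum.inter_filter[OF finS])
    also have "\<dots> = h \<alpha> n"
      unfolding h_def sum_distrib_left by (intro sum.cong refl) (simp add: indicator_def)
    finally show ?thesis ..
  qed

  have int_h: "(\<integral>\<^sup>+\<alpha>. ennreal (h \<alpha> n) \<partial>lborel)
      \<le> ennreal (18 * B^2 * C * 2 powr s * real (Suc n) powr (2 - \<tau> * (1 + s)))" for n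
  proof -
    have "(\<integral>\<^sup>+\<alpha>. ennreal (h \<alpha> n) \<partial>lborel)
        = (\<integral>\<^sup>+\<alpha>. ennreal ((2 * \<rho> n) powr s) * (\<Sum>pr\<in>S n \<times> S n. indicator (E n pr) \<alpha>) \<partial>lborel)"
      unfolding h_def
      by (intro nn_integral_cong) (simp add: ennreal_mult sum_nonneg flip: sum_ennreal ennreal_indicator)
    also have "\<dots> = ennreal ((2 * \<rho> n) powr s) * (\<Sum>pr\<in>S n \<times> S n. emeasure lborel (E n pr))"
      using E_meas by (simp add: nn_integral_cmult nn_integral_sum)
    also have "(\<Sum>pr\<in>S n \<times> S n. emeasure lborel (E n pr)) = (\<Sum>pr\<in>S n \<times> S n. ennreal (2 * C * \<rho> n))"
    proof (rule sum.cong)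
      fix pr
      have "emeasure lborel (ball c (C * \<rho> n)) = ennreal (2 * C * \<rho> n)" for c :: real
        using \<rho>(1)[of n] \<open>C > 0\<close> by (simp add: ball_eq_greaterThanLessThan mult.assoc)
      then show "emeasure lborel (E n pr) = ennreal (2 * C * \<rho> n)"
        by (simp add: E_def split: prod.split)
    qed simp
    also have "\<dots> = ennreal (real (card (S n)) ^ 2 * (2 * C * \<rho> n))"
      using \<rho>(1)[of n] \<open>C > 0\<close>
      by (simp add: card_cartesian_product ennreal_mult power2_eq_square ennreal_of_nat_eq_real_of_nat)
    also have "ennreal ((2 * \<rho> n) powr s) * \<dots>
        = ennreal ((2 * \<rho> n) powr s * (real (card (S n)) ^ 2 * (2 * C * \<rho> n)))"
      using \<rho>(1)[of n] \<open>C > 0\<close> by (simp add: ennreal_mult)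
    also have "\<dots> \<le> ennreal ((2 * \<rho> n) powr s * ((3 * B * real (Suc n)) ^ 2 * (2 * C * \<rho> n)))"
    proof -
      \<comment> \<open>The summand 1 is absorbed through \<open>B * Suc n\<close> \<ge> 1, giving
        the factor 3.\<close>
      have "card (S n) = 2 * (B * Suc n) + 1" unfolding S_def by (simp del: of_nat_mult of_nat_Suc)
      moreover have "1 \<le> B * Suc n" using B(1) by simp
      ultimately have "card (S n) \<le> 3 * (B * Suc n)" by linarith
      then have "real (card (S n)) \<le> real (3 * (B * Suc n))" by (rule of_nat_mono)
      then have "real (card (S n)) \<le> 3 * B * real (Suc n)" by (simp only: of_nat_mult of_nat_numeral mult.assoc)
      then show ?thesis
        using \<rho>(1)[of n] \<open>C > 0\<close> by (intro ennreal_leI mult_left_mono mult_right_mono power_mono) auto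
    qed
    also have "(2 * \<rho> n) powr s * ((3 * B * real (Suc n)) ^ 2 * (2 * C * \<rho> n))
        = 18 * B^2 * C * 2 powr s * (real (Suc n) ^ 2 * (\<rho> n * \<rho> n powr s))"
      using \<rho>(1)[of n] by (simp add: powr_mult power_mult_distrib)
    also have "real (Suc n) ^ 2 * (\<rho> n * \<rho> n powr s) = real (Suc n) powr (2 - \<tau> * (1 + s))"
      by (simp add: \<rho>_def powr_powr algebra_simps flip: powr_add powr_numeral)
    finally show ?thesis .
  qed

  have "(\<integral>\<^sup>+\<alpha>. (\<Sum>n. ennreal (h \<alpha> n)) \<partial>lborel) = (\<Sum>n. \<integral>\<^sup>+\<alpha>. ennreal (h \<alpha> n) \<partial>lborel)"
    using E_meas by (intro nn_integral_suminf) (auto simp: h_def)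
  also have "\<dots> \<le> (\<Sum>n. ennreal (18 * B^2 * C * 2 powr s * real (Suc n) powr (2 - \<tau> * (1 + s))))"
    by (intro suminf_le int_h) auto
  also have "\<dots> < \<infinity>"
  proof -
    \<comment> \<open>The assumption \<open>exponent\<close> says exactly that this power is below
      -1.\<close>
    have "summable (\<lambda>n. real n powr (2 - \<tau> * (1 + s)))"
      using exponent by (simp add: summable_real_powr_iff)
    then have "summable (\<lambda>n. 18 * B^2 * C * 2 powr s * real (Suc n) powr (2 - \<tau> * (1 + s)))"
      by (intro summable_mult) (subst summable_Suc_iff)
    then have "(\<Sum>n. ennreal (18 * B^2 * C * 2 powr s * real (Suc n) powr (2 - \<tau> * (1 + s)))) \<noteq> top"
      using \<open>C > 0\<close> by (intro ennreal_suminf_neq_top) auto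
    then show ?thesis by (simp only: less_top infinity_ennreal_def)
  qed
  \<comment> \<open>A nonnegative function with finite integral is finite almost everywhere; for
    such \<alpha> the \<open>s\<close>-sum of the cover converges.\<close>
  finally have "AE \<alpha> in lborel. (\<Sum>n. ennreal (h \<alpha> n)) \<noteq> \<infinity>"
    using E_meas by (intro nn_integral_PInf_AE) (auto simp: h_def)
  then show ?thesis
  proof (rule AE_mp, intro AE_I2 impI)
    fix \<alpha> :: real
    assume "(\<Sum>n. ennreal (h \<alpha> n)) \<noteq> \<infinity>" and \<alpha>: "\<bar>\<alpha>\<bar> \<le> M"
    then have "summable (h \<alpha>)"
      using h_nonneg by (intro summable_suminf_not_top) auto
    show "hausdorff_measure s (W_approx \<tau> (\<lambda>x. f x + \<alpha>) \<inter> {- real M..real M}) = 0"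
    proof (rule hausdorff_measure_limsup_eq_0[OF \<open>s > 0\<close>])
      show "finite (I \<alpha> n)" for n using finS[of n] by (simp add: I_def)
      show "bounded (U n pr)" for n pr by (auto simp: U_def split: prod.split)
      show "summable (\<lambda>n. \<Sum>pr\<in>I \<alpha> n. diameter (U n pr) powr s)"
        using \<open>summable (h \<alpha>)\<close> by (simp only: h_eq[symmetric])
    next
      fix x assume x: "x \<in> W_approx \<tau> (\<lambda>x. f x + \<alpha>) \<inter> {- real M..real M}"
      then have "\<exists>\<^sub>\<infinity>n. \<exists>(p :: int) (r :: int). \<bar>x - p / Suc n\<bar> < \<rho> n \<and> \<bar>f x + \<alpha> - r / Suc n\<bar> < \<rho> n"
        using infinitely_many_denominators[of x \<tau> "\<lambda>x. f x + \<alpha>"] \<open>\<tau> > 0\<close> by (simp add: \<rho>_def)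
      then show "\<exists>\<^sub>\<infinity>n. \<exists>pr\<in>I \<alpha> n. x \<in> U n pr"
      proof (rule INFM_mono, elim exE conjE)
        fix n and p r :: int
        assume p: "\<bar>x - p / Suc n\<bar> < \<rho> n" and r: "\<bar>f x + \<alpha> - r / Suc n\<bar> < \<rho> n"
        define y where "y = real_of_int p / Suc n"
        have xM: "\<bar>x\<bar> \<le> M" using x by auto
        have yM: "\<bar>y\<bar> \<le> real M + 1" using p \<rho>(2)[of n] xM unfolding y_def[symmetric] by linarith
        have rM: "\<bar>r / Suc n\<bar> \<le> D + real M + 1"
          using r \<rho>(2)[of n] D[of x] xM \<alpha> by linarith
        have num: "u \<in> S n" if "\<bar>of_int u / real (Suc n)\<bar> \<le> B" for u :: int
        proof -
          have "\<bar>of_int u\<bar> \<le> real B * real (Suc n)" using that by (simp add: field_simps)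
          then have "real_of_int \<bar>u\<bar> \<le> real_of_int (int (B * Suc n))" by (simp add: algebra_simps)
          then have "\<bar>u\<bar> \<le> int (B * Suc n)" by (simp only: of_int_le_iff)
          then show ?thesis unfolding S_def atLeastAtMost_iff by linarith
        qed
        have "p \<in> S n" "r \<in> S n" using num[of p] num[of r] yM rM B unfolding y_def by linarith+
        moreover have "\<alpha> \<in> E n (p, r)"
        proof -
          \<comment> \<open>Both points lie in the enlarged interval, so the Lipschitz bound moves
            the approximation from x to the rational point \<open>y\<close> and places \<alpha> in
            \<open>E n (p, r)\<close>.\<close>
          have "\<bar>f y - f x\<bar> \<le> L * \<bar>y - x\<bar>"
            using lipschitz_onD[OF lip, of y x] yM xM by (auto simp: dist_real_def abs_le_iff)
          also have "\<dots> \<le> L * \<rho> n"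
            using p \<open>L \<ge> 0\<close> by (intro mult_left_mono) (auto simp: y_def)
          finally have "\<bar>r / Suc n - f y - \<alpha>\<bar> < C * \<rho> n"
            using r by (simp add: C_def distrib_right)
          then show ?thesis by (simp add: E_def dist_real_def y_def)
        qed
        moreover have "x \<in> U n (p, r)"
          using p by (simp add: U_def dist_real_def abs_minus_commute)
        ultimately show "\<exists>pr\<in>I \<alpha> n. x \<in> U n pr" by (auto simp: I_def)
      qed
    qed
  qed
qed

text \<open>The exceptional null sets for all natural \<open>M\<close> are united. For a remaining
  \<alpha>, starting the exhaustion of the line at some \<open>M\<^sub>0\<close> \<ge> |\<alpha>|
  makes the bounded case apply to every window.\<close>

lemma AE_hausdorff_measure_W_approx_eq_0:
  fixes f :: "real \<Rightarrow> real"
  assumes "\<tau> > 0" "s > 0" "\<tau> * (1 + s) > 3"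
    and lip: "\<And>a b. \<exists>L. L-lipschitz_on {a..b} f"
  shows "AE \<alpha> in lborel. hausdorff_measure s (W_approx \<tau> (\<lambda>x. f x + \<alpha>)) = 0"
proof -
  have "AE \<alpha> in lborel. \<forall>M :: nat. \<bar>\<alpha>\<bar> \<le> M \<longrightarrow>
           hausdorff_measure s (W_approx \<tau> (\<lambda>x. f x + \<alpha>) \<inter> {- real M..real M}) = 0"
    using assms AE_hausdorff_measure_W_approx_bounded unfolding AE_all_countable by blast
  then show ?thesis
  proof (rule AE_mp, intro AE_I2 impI)
    fix \<alpha> :: real
    let ?W = "W_approx \<tau> (\<lambda>x. f x + \<alpha>)"
    assume null: "\<forall>M :: nat. \<bar>\<alpha>\<bar> \<le> M \<longrightarrow> hausdorff_measure s (?W \<inter> {- real M..real M}) = 0"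
    obtain M\<^sub>0 :: nat where M\<^sub>0: "\<bar>\<alpha>\<bar> \<le> M\<^sub>0" using real_arch_simple by blast
    have "?W \<subseteq> (\<Union>k. ?W \<inter> {- real (M\<^sub>0 + k)..real (M\<^sub>0 + k)})"
    proof
      fix x assume "x \<in> ?W"
      obtain k :: nat where "\<bar>x\<bar> \<le> k" using real_arch_simple by blast
      then have "x \<in> {- real (M\<^sub>0 + k)..real (M\<^sub>0 + k)}" by auto
      with \<open>x \<in> ?W\<close> show "x \<in> (\<Union>k. ?W \<inter> {- real (M\<^sub>0 + k)..real (M\<^sub>0 + k)})" by blast
    qed
    moreover have "hausdorff_measure s (\<Union>k. ?W \<inter> {- real (M\<^sub>0 + k)..real (M\<^sub>0 + k)}) = 0"
    proof (rule hausdorff_measure_UN_eq_0)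
      show "hausdorff_measure s (?W \<inter> {- real (M\<^sub>0 + k)..real (M\<^sub>0 + k)}) = 0" for k
        using M\<^sub>0 by (intro null[rule_format]) simp
    qed
    ultimately show "hausdorff_measure s ?W = 0" by (rule hausdorff_measure_mono_0)
  qed
qed

section \<open>Polynomials and the dimension bound\<close>

lemma poly_lipschitz_on_interval:
  fixes p :: "real poly"
  shows "\<exists>L. L-lipschitz_on {a..b} (poly p)"
proof -
  have "bounded (poly (pderiv p) ` {a..b})"
    by (intro compact_imp_bounded compact_continuous_image continuous_intros) auto
  then obtain L where L: "\<And>x. x \<in> {a..b} \<Longrightarrow> \<bar>poly (pderiv p) x\<bar> \<le> L" "L > 0"
    unfolding bounded_pos by (metis image_eqI real_norm_def)
  have "L-lipschitz_on {a..b} (poly p)"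
  proof (rule bounded_derivative_imp_lipschitz)
    show "(poly p has_derivative (*) (poly (pderiv p) x)) (at x within {a..b})" for x
      using poly_DERIV[of p x] unfolding has_field_derivative_def by (rule has_derivative_at_withinI)
    show "onorm ((*) (poly (pderiv p) x)) \<le> L" if "x \<in> {a..b}" for x
      using L(1)[OF that] by (intro onorm_le) (simp add: abs_mult mult_right_mono)
  qed (use L(2) in auto)
  then show ?thesis ..
qed

theorem theorem1p5:
  fixes P :: "int poly" and d :: nat and \<tau> :: real
  assumes "degree P = d"
    and "d \<ge> 2"
    and "\<tau> \<in> {real d <.. real d + 1}"
  shows "AE \<alpha> in lebesgue.
           hausdorff_dim (W_approx \<tau> (poly_plus_const P \<alpha>)) \<le> ereal ((real d + 1 - \<tau>) / \<tau>)"
proof -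
  \<comment> \<open>A countable sequence of exponents tending to the bound from above keeps the
    exceptional set null. The added term keeps \<open>s k\<close> positive also for \<tau> = d + 1,
    where the bound itself is 0.\<close>
  define s where "s k = (real d + 1 - \<tau>) / \<tau> + 1 / real (Suc k)" for k
  have "\<tau> > 0" using assms by auto
  have s_pos: "s k > 0" for k using assms \<open>\<tau> > 0\<close> unfolding s_def by (intro add_nonneg_pos) auto
  have exponent: "\<tau> * (1 + s k) > 3" for k
  proof -
    \<comment> \<open>The product is d + 1 plus a positive term, so it exceeds 3 because d \<ge>
      2.\<close>
    have "\<tau> * (1 + s k) = real d + 1 + \<tau> / Suc k" using \<open>\<tau> > 0\<close> by (simp add: s_def distrib_left del: of_nat_Suc)
    moreover have "\<tau> / Suc k > 0" using \<open>\<tau> > 0\<close> by simp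
    ultimately show ?thesis using assms(2) by linarith
  qed
  have "AE \<alpha> in lborel. \<forall>k. hausdorff_measure (s k) (W_approx \<tau> (poly_plus_const P \<alpha>)) = 0"
    unfolding AE_all_countable poly_plus_const_def[abs_def]
    using AE_hausdorff_measure_W_approx_eq_0[OF \<open>\<tau> > 0\<close> s_pos exponent poly_lipschitz_on_interval]
    by blast
  then have "AE \<alpha> in lborel.
      hausdorff_dim (W_approx \<tau> (poly_plus_const P \<alpha>)) \<le> ereal ((real d + 1 - \<tau>) / \<tau>)"
  proof (rule AE_mp, intro AE_I2 impI)
    fix \<alpha> :: real
    assume "\<forall>k. hausdorff_measure (s k) (W_approx \<tau> (poly_plus_const P \<alpha>)) = 0"
    then have "hausdorff_dim (W_approx \<tau> (poly_plus_const P \<alpha>)) \<le> ereal (s k)" for k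
      unfolding hausdorff_dim_def using s_pos[of k] by (intro Inf_lower) auto
    moreover have "s \<longlonglongrightarrow> (real d + 1 - \<tau>) / \<tau> + 0"
      unfolding s_def by (intro tendsto_add tendsto_const LIMSEQ_inverse_real_of_nat[unfolded inverse_eq_divide])
    ultimately show "hausdorff_dim (W_approx \<tau> (poly_plus_const P \<alpha>)) \<le> ereal ((real d + 1 - \<tau>) / \<tau>)"
      by (intro LIMSEQ_le_const[of "\<lambda>k. ereal (s k)"]) auto
  qed
  \<comment> \<open>\<open>lebesgue\<close> is the completion of \<open>lborel\<close>, so the
    exceptional set stays null.\<close>
  then show ?thesis by (rule AE_completion)
qed

end
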